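(* Let $M$ be a two-dimensional smooth manifold with a Lorentzian metric $g$, and let $X_1, X_2$ be smooth vector fields on $M$ forming a basis of $T_qM$ at every point $q\in M$, such that $g(X_1,X_1)=a_{11}$, $g(X_2,X_2)=a_{22}$, $g(X_1,X_2)=g(X_2,X_1)=a_{12}=a_{21}$, where the $a_{ij}$ are real constants. Let $c_{12}^1, c_{12}^2\in C^\infty(M)$ be the structure functions defined by $[X_1,X_2]=c_{12}^1X_1+c_{12}^2X_2$. Set $$A=a_{11}c_{12}^1+a_{12}c_{12}^2,\qquad B=a_{12}c_{12}^1+a_{22}c_{12}^2,\qquad \mathcal{A}=\begin{pmatrix}a_{11}&a_{12}\\ a_{12}&a_{22}\end{pmatrix},$$ $$\xi_1=a_{12}\left[(c_{12}^1A+c_{12}^2B)-(X_1B)+(X_2A)\right],\qquad \xi_2=a_{11}\left[-(c_{12}^1A+c_{12}^2B)+(X_1B)-(X_2A)\right].$$ Then the sectional curvature of $(M,g)$ is, at every point of $M$, $$K=\frac{a_{12}\xi_1+a_{22}\xi_2}{(\det\mathcal{A})^2}.$$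
   Context: A Lorentzian metric $g$ on $M$ is a smooth symmetric nondegenerate $(0,2)$-tensor field of index one (one negative direction). For a vector field $X$ and a smooth function $f$, $Xf$ denotes the derivative of $f$ along $X$. $[V,W]$ is the Lie bracket of vector fields, acting on functions by $[V,W]f=V(Wf)-W(Vf)$. $D$ denotes the Levi-Civita connection of $g$: the unique connection with $[V,W]=D_VW-D_WV$ and $Xg(V,W)=g(D_XV,W)+g(V,D_XW)$ for all smooth vector fields $X,V,W$. The Riemann curvature tensor is taken with the sign convention $R_{XY}Z=D_{[X,Y]}Z-[D_X,D_Y]Z$, where $[D_X,D_Y]=D_XD_Y-D_YD_X$; it assigns to three vector fields a vector field. For $v,w\in T_qM$ put $Q(v,w)=g(v,v)g(w,w)-(g(v,w))^2$. The sectional curvature of a plane $P\subseteq T_qM$ that is nondegenerate (i.e. $Q(v,w)\neq0$ for a basis $v,w$ of $P$) is $K(q,P)=\dfrac{g(R_{vw}v,w)}{Q(v,w)}$, which is independent of the basis $v,w$ of $P$. Since $\dim M=2$, the only plane at $q$ is $P=T_qM$, and $K$ is regarded as a function on $M$. *)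

theory Defs
  imports "HOL-Analysis.Analysis" "HOL-Library.Function_Algebras"
begin

section \<open>Functions into a real vector space form a real vector space\<close>

text \<open>This makes \<^const>\<open>subspace\<close>, \<^const>\<open>span\<close>, \<^const>\<open>independent\<close> and \<^const>\<open>dim\<close>
  available for tangent vectors, which are functionals on real-valued functions.\<close>

instantiation "fun" :: (type, real_vector) real_vector
begin

definition scaleR_fun :: "real \<Rightarrow> ('a \<Rightarrow> 'b) \<Rightarrow> 'a \<Rightarrow> 'b"
  where "scaleR_fun c f = (\<lambda>x. c *\<^sub>R f x)"

instance
  by standard (auto simp: scaleR_fun_def fun_eq_iff scaleR_add_right scaleR_add_left)

end


section \<open>Smooth manifolds\<close>

text \<open>Only meant for open \<open>S\<close>.\<close>

primrec Ck_on :: "nat \<Rightarrow> ('a::real_normed_vector \<Rightarrow> 'b::real_normed_vector) \<Rightarrow> 'a set \<Rightarrow> bool"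
where
  "Ck_on 0 f S \<longleftrightarrow> continuous_on S f"
| "Ck_on (Suc k) f S \<longleftrightarrow>
     (\<forall>x\<in>S. f differentiable (at x)) \<and>
     (\<forall>v. Ck_on k (\<lambda>x. frechet_derivative f (at x) v) S)"

definition smooth_on :: "'a::real_normed_vector set \<Rightarrow> ('a \<Rightarrow> 'b::real_normed_vector) \<Rightarrow> bool"
  where "smooth_on S f \<longleftrightarrow> (\<forall>k. Ck_on k f S)"

text \<open>A chart is a pair of its domain and its coordinate map; the values of the coordinate map
  outside the domain are irrelevant.\<close>

type_synonym ('a, 'n) chart = "'a set \<times> ('a \<Rightarrow> real ^ 'n)"

definition chart_of :: "'a topology \<Rightarrow> ('a, 'n::finite) chart \<Rightarrow> bool"
  where "chart_of M = (\<lambda>(U, \<phi>). openin M U \<and> open (\<phi> ` U) \<and>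
     homeomorphic_map (subtopology M U) (top_of_set (\<phi> ` U)) \<phi>)"

definition smooth_transition :: "('a, 'n::finite) chart \<Rightarrow> ('a, 'n) chart \<Rightarrow> bool"
  where "smooth_transition = (\<lambda>(U, \<phi>) (V, \<psi>). smooth_on (\<phi> ` (U \<inter> V)) (\<psi> \<circ> inv_into U \<phi>))"

text \<open>The atlas \<open>\<A>\<close> need not be maximal; it represents the smooth structure it generates.\<close>

definition smooth_manifold :: "'a topology \<Rightarrow> ('a, 'n::finite) chart set \<Rightarrow> bool"
  where "smooth_manifold M \<A> \<longleftrightarrow>
     Hausdorff_space M \<and> second_countable M \<and>
     (\<forall>c\<in>\<A>. chart_of M c) \<and>
     (\<Union>c\<in>\<A>. fst c) = topspace M \<and>
     (\<forall>c\<in>\<A>. \<forall>d\<in>\<A>. smooth_transition c d)"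

text \<open>Points of the manifold are the elements of \<^term>\<open>topspace M\<close>.  Membership in
  \<open>smooth_funs \<A>\<close> does not constrain the values outside of it.\<close>

definition smooth_funs :: "('a, 'n::finite) chart set \<Rightarrow> ('a \<Rightarrow> real) set"
  where "smooth_funs \<A> = {f. \<forall>(U, \<phi>)\<in>\<A>. smooth_on (\<phi> ` U) (f \<circ> inv_into U \<phi>)}"


section \<open>Tangent vectors and vector fields\<close>

text \<open>Tangent vectors at \<open>q\<close> are the derivations at \<open>q\<close> of the algebra of smooth functions.  Being
  total HOL functions, they are normalised to be \<open>0\<close> on nonsmooth arguments.  Their value
  depends only on the restriction of a smooth \<open>f\<close> to the manifold: if \<open>f\<close> vanishes there and \<open>h\<close> is
  \<open>0\<close> on the manifold and \<open>1\<close> outside, then \<open>f = f h\<close>, and the Leibniz rule gives \<open>v f = 0\<close>.\<close>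

type_synonym 'a tvec = "('a \<Rightarrow> real) \<Rightarrow> real"

definition tangent_space :: "('a, 'n::finite) chart set \<Rightarrow> 'a \<Rightarrow> 'a tvec set"
  where "tangent_space \<A> q = {v.
     (\<forall>f\<in>smooth_funs \<A>. \<forall>h\<in>smooth_funs \<A>. v (\<lambda>p. f p + h p) = v f + v h) \<and>
     (\<forall>c. \<forall>f\<in>smooth_funs \<A>. v (\<lambda>p. c * f p) = c * v f) \<and>
     (\<forall>f\<in>smooth_funs \<A>. \<forall>h\<in>smooth_funs \<A>. v (\<lambda>p. f p * h p) = f q * v h + h q * v f) \<and>
     (\<forall>f. f \<notin> smooth_funs \<A> \<longrightarrow> v f = 0)}"

text \<open>A vector field \<open>X\<close> assigns to each point \<open>q\<close> a tangent vector \<open>X q\<close>, so that \<open>X q f\<close> is the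
  value at \<open>q\<close> of the derivative of \<open>f\<close> along \<open>X\<close>.\<close>

type_synonym 'a vfield = "'a \<Rightarrow> 'a tvec"

definition along :: "'a vfield \<Rightarrow> ('a \<Rightarrow> real) \<Rightarrow> 'a \<Rightarrow> real"
  where "along X f = (\<lambda>q. X q f)"

definition vector_fields :: "'a topology \<Rightarrow> ('a, 'n::finite) chart set \<Rightarrow> 'a vfield set"
  where "vector_fields M \<A> = {X.
     (\<forall>q\<in>topspace M. X q \<in> tangent_space \<A> q) \<and>
     (\<forall>f\<in>smooth_funs \<A>. along X f \<in> smooth_funs \<A>)}"

definition lie_bracket :: "'a vfield \<Rightarrow> 'a vfield \<Rightarrow> 'a vfield"
  where "lie_bracket V W = (\<lambda>q f. V q (along W f) - W q (along V f))"

definition is_basis :: "'v::real_vector \<Rightarrow> 'v \<Rightarrow> 'v set \<Rightarrow> bool"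
  where "is_basis v w P \<longleftrightarrow> v \<noteq> w \<and> independent {v, w} \<and> span {v, w} = P"


section \<open>Lorentzian metrics\<close>

type_synonym 'a metric_tensor = "'a \<Rightarrow> 'a tvec \<Rightarrow> 'a tvec \<Rightarrow> real"

definition index_of_form :: "('v::real_vector \<Rightarrow> 'v \<Rightarrow> real) \<Rightarrow> 'v set \<Rightarrow> nat"
  where "index_of_form b T =
     (GREATEST n. \<exists>W. subspace W \<and> W \<subseteq> T \<and> dim W = n \<and> (\<forall>w\<in>W. w \<noteq> 0 \<longrightarrow> b w w < 0))"

definition lorentzian_metric ::
    "'a topology \<Rightarrow> ('a, 'n::finite) chart set \<Rightarrow> 'a metric_tensor \<Rightarrow> bool"
  where "lorentzian_metric M \<A> g \<longleftrightarrow>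
     (\<forall>q\<in>topspace M.
        (\<forall>u\<in>tangent_space \<A> q. \<forall>v\<in>tangent_space \<A> q. \<forall>w\<in>tangent_space \<A> q. \<forall>c d.
           g q (c *\<^sub>R u + d *\<^sub>R v) w = c * g q u w + d * g q v w) \<and>
        (\<forall>v\<in>tangent_space \<A> q. \<forall>w\<in>tangent_space \<A> q. g q v w = g q w v) \<and>
        (\<forall>v\<in>tangent_space \<A> q. (\<forall>w\<in>tangent_space \<A> q. g q v w = 0) \<longrightarrow> v = 0) \<and>
        index_of_form (g q) (tangent_space \<A> q) = 1) \<and>
     (\<forall>V\<in>vector_fields M \<A>. \<forall>W\<in>vector_fields M \<A>. (\<lambda>q. g q (V q) (W q)) \<in> smooth_funs \<A>)"


section \<open>Levi-Civita connection\<close>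

text \<open>\<open>D V W\<close> stands for $D_V W$.  All identities are required at the points of the manifold only.\<close>

type_synonym 'a conn = "'a vfield \<Rightarrow> 'a vfield \<Rightarrow> 'a vfield"

definition connection :: "'a topology \<Rightarrow> ('a, 'n::finite) chart set \<Rightarrow> 'a conn \<Rightarrow> bool"
  where "connection M \<A> D \<longleftrightarrow>
     (\<forall>V\<in>vector_fields M \<A>. \<forall>W\<in>vector_fields M \<A>.
        D V W \<in> vector_fields M \<A> \<and>
        (\<forall>U\<in>vector_fields M \<A>. \<forall>q\<in>topspace M.
           D (\<lambda>p. U p + V p) W q = D U W q + D V W q \<and>
           D U (\<lambda>p. V p + W p) q = D U V q + D U W q) \<and>
        (\<forall>f\<in>smooth_funs \<A>. \<forall>q\<in>topspace M.
           D (\<lambda>p. f p *\<^sub>R V p) W q = f q *\<^sub>R D V W q \<and>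
           D V (\<lambda>p. f p *\<^sub>R W p) q = along V f q *\<^sub>R W q + f q *\<^sub>R D V W q))"

definition levi_civita ::
    "'a topology \<Rightarrow> ('a, 'n::finite) chart set \<Rightarrow> 'a metric_tensor \<Rightarrow> 'a conn \<Rightarrow> bool"
  where "levi_civita M \<A> g D \<longleftrightarrow> connection M \<A> D \<and>
     (\<forall>V\<in>vector_fields M \<A>. \<forall>W\<in>vector_fields M \<A>. \<forall>q\<in>topspace M.
        lie_bracket V W q = D V W q - D W V q) \<and>
     (\<forall>X\<in>vector_fields M \<A>. \<forall>V\<in>vector_fields M \<A>. \<forall>W\<in>vector_fields M \<A>. \<forall>q\<in>topspace M.
        along X (\<lambda>p. g p (V p) (W p)) q = g q (D X V q) (W q) + g q (V q) (D X W q))"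


section \<open>Curvature\<close>

definition riemann :: "'a conn \<Rightarrow> 'a vfield \<Rightarrow> 'a vfield \<Rightarrow> 'a vfield \<Rightarrow> 'a vfield"
  where "riemann D X Y Z =
     (\<lambda>q. D (lie_bracket X Y) Z q - (D X (D Y Z) q - D Y (D X Z) q))"

text \<open>The value $R_{xy}z$ on tangent vectors at \<open>q\<close>: the common value at \<open>q\<close> of $R_{XY}Z$ for all
  smooth vector fields $X$, $Y$, $Z$ extending $x$, $y$, $z$.\<close>

definition riemann_at :: "'a topology \<Rightarrow> ('a, 'n::finite) chart set \<Rightarrow> 'a conn \<Rightarrow> 'a \<Rightarrow>
    'a tvec \<Rightarrow> 'a tvec \<Rightarrow> 'a tvec \<Rightarrow> 'a tvec"
  where "riemann_at M \<A> D q x y z =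
     (THE r. \<forall>X\<in>vector_fields M \<A>. \<forall>Y\<in>vector_fields M \<A>. \<forall>Z\<in>vector_fields M \<A>.
        X q = x \<and> Y q = y \<and> Z q = z \<longrightarrow> riemann D X Y Z q = r)"

definition Q_form :: "'a metric_tensor \<Rightarrow> 'a \<Rightarrow> 'a tvec \<Rightarrow> 'a tvec \<Rightarrow> real"
  where "Q_form g q v w = g q v v * g q w w - (g q v w)\<^sup>2"

text \<open>Meaningful for nondegenerate planes \<open>P\<close> only, where \<^const>\<open>Q_form\<close> is nonzero on every basis
  and the quotient is the same for all bases of \<open>P\<close>.\<close>

definition sectional_curvature ::
    "'a topology \<Rightarrow> ('a, 'n::finite) chart set \<Rightarrow> 'a metric_tensor \<Rightarrow> 'a conn \<Rightarrow> 'a \<Rightarrow>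
     'a tvec set \<Rightarrow> real"
  where "sectional_curvature M \<A> g D q P =
     (THE k. \<forall>v w. is_basis v w P \<longrightarrow>
        k = g q (riemann_at M \<A> D q v w v) w / Q_form g q v w)"

end

theory Submission
  imports Defs
begin

text \<open>Since the inner products of the frame are constant, each \<open>D\<^sub>X\<close> is skew-adjoint on it, so the
  connection is determined by the single form \<open>\<omega>(X) = g(D\<^sub>X X\<^sub>1, X\<^sub>2)\<close>, and vanishing torsion
  gives \<open>\<omega>(X\<^sub>1) = -A\<close>, \<open>\<omega>(X\<^sub>2) = -B\<close>.  The terms of \<open>g(R X\<^sub>1, X\<^sub>2)\<close> that are quadratic in \<open>\<omega>\<close>
  cancel, which leaves \<open>X\<^sub>1 B - X\<^sub>2 A - (c\<^sub>1 A + c\<^sub>2 B)\<close>; dividing by the Gram determinant gives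
  \<open>K\<close>.  Tensoriality of the curvature needs no bump functions, because the frame is global and
  every vector field has smooth coefficients in it.\<close>

section \<open>Smooth functions\<close>

lemma frechet_derivative_transform_open:
  assumes "open S" "x \<in> S" "\<And>y. y \<in> S \<Longrightarrow> f y = h y" "f differentiable (at x)"
  shows "h differentiable (at x)" "frechet_derivative h (at x) = frechet_derivative f (at x)"
proof -
  have "(f has_derivative frechet_derivative f (at x)) (at x)"
    using assms(4) by (simp add: frechet_derivative_works)
  then have h: "(h has_derivative frechet_derivative f (at x)) (at x)"
    using assms(1-3) by (rule has_derivative_transform_within_open)
  then show "h differentiable (at x)"
    by (auto simp: differentiable_def)
  show "frechet_derivative h (at x) = frechet_derivative f (at x)"
    using frechet_derivative_at[OF h] by simp
qed

text \<open>Derivatives are taken in the ambient space, so agreement on \<open>S\<close> controls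
  them because \<open>S\<close> contains a neighbourhood of each of its points. The sum and product
  rules use this to trade the derivative of a compound for its explicit formula, which is known only
  on \<open>S\<close>.\<close>

lemma Ck_on_cong:
  assumes "open S" "\<And>x. x \<in> S \<Longrightarrow> f x = h x" "Ck_on k f S"
  shows "Ck_on k h S"
  using assms(2,3)
proof (induction k arbitrary: f h)
  case 0
  then show ?case
    using continuous_on_cong[of S S f h] by simp
next
  case (Suc k)
  have "frechet_derivative f (at x) v = frechet_derivative h (at x) v" if "x \<in> S" for x v
    using frechet_derivative_transform_open[of S x f h] \<open>open S\<close> that Suc.prems by simp
  then have "Ck_on k (\<lambda>x. frechet_derivative h (at x) v) S" for v
    using Suc.IH[of "\<lambda>x. frechet_derivative f (at x) v" "\<lambda>x. frechet_derivative h (at x) v"]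
      Suc.prems(2) by simp
  moreover have "h differentiable (at x)" if "x \<in> S" for x
    using frechet_derivative_transform_open(1)[of S x f h] \<open>open S\<close> that Suc.prems by simp
  ultimately show ?case by simp
qed

lemma Ck_on_SucD: "Ck_on (Suc k) f S \<Longrightarrow> Ck_on k f S"
proof (induction k arbitrary: f)
  case 0
  then show ?case
    by (auto intro!: continuous_at_imp_continuous_on differentiable_imp_continuous_within)
next
  case (Suc k)
  then show ?case by (metis Ck_on.simps(2))
qed

lemma Ck_on_const: "Ck_on k (\<lambda>x. c) S"
  by (induction k arbitrary: c) auto

lemma Ck_on_add:
  assumes "open S" "Ck_on k f S" "Ck_on k h S"
  shows "Ck_on k (\<lambda>x. f x + h x) S"
  using assms(2,3)
proof (induction k arbitrary: f h)
  case 0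
  then show ?case by (simp add: continuous_on_add)
next
  case (Suc k)
  have "Ck_on k (\<lambda>x. frechet_derivative (\<lambda>x. f x + h x) (at x) v) S" for v
  proof (rule Ck_on_cong[OF \<open>open S\<close>])
    show "Ck_on k (\<lambda>x. frechet_derivative f (at x) v + frechet_derivative h (at x) v) S"
      using Suc by simp
    fix x assume "x \<in> S"
    then have "((\<lambda>x. f x + h x) has_derivative
        (\<lambda>v. frechet_derivative f (at x) v + frechet_derivative h (at x) v)) (at x)"
      using Suc.prems by (intro has_derivative_add) (simp_all add: frechet_derivative_works)
    from frechet_derivative_at[OF this]
    show "frechet_derivative f (at x) v + frechet_derivative h (at x) v =
        frechet_derivative (\<lambda>x. f x + h x) (at x) v"
      by metis
  qed
  then show ?case using Suc.prems by simp
qed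

lemma Ck_on_mult:
  fixes f h :: "'a::real_normed_vector \<Rightarrow> real"
  assumes "open S" "Ck_on k f S" "Ck_on k h S"
  shows "Ck_on k (\<lambda>x. f x * h x) S"
  using assms(2,3)
proof (induction k arbitrary: f h)
  case 0
  then show ?case by (simp add: continuous_on_mult)
next
  case (Suc k)
  have "Ck_on k (\<lambda>x. frechet_derivative (\<lambda>x. f x * h x) (at x) v) S" for v
  proof (rule Ck_on_cong[OF \<open>open S\<close>])
    show "Ck_on k (\<lambda>x. f x * frechet_derivative h (at x) v +
        frechet_derivative f (at x) v * h x) S"
      \<comment> \<open>The undifferentiated factors are of class \<open>Suc k\<close> and must be
        lowered to \<open>k\<close> before the induction hypothesis applies to the products.\<close>
      using Suc Ck_on_SucD[of k f S] Ck_on_SucD[of k h S]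
      by (intro Ck_on_add \<open>open S\<close> Suc.IH) simp_all
    fix x assume "x \<in> S"
    then have "((\<lambda>x. f x * h x) has_derivative
        (\<lambda>v. f x * frechet_derivative h (at x) v + frechet_derivative f (at x) v * h x)) (at x)"
      using Suc.prems by (intro has_derivative_mult) (simp_all add: frechet_derivative_works)
    from frechet_derivative_at[OF this]
    show "f x * frechet_derivative h (at x) v + frechet_derivative f (at x) v * h x =
        frechet_derivative (\<lambda>x. f x * h x) (at x) v"
      by metis
  qed
  then show ?case using Suc.prems by simp
qed


section \<open>Vector fields on a manifold\<close>

locale smooth_mfd =
  fixes M :: "'a topology" and \<A> :: "('a, 'n::finite) chart set"
  assumes manifold: "smooth_manifold M \<A>"
begin

section \<open>Charts and the algebra of smooth functions\<close>

lemma chart: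
  assumes "(U, \<phi>) \<in> \<A>"
  shows "U \<subseteq> topspace M" "open (\<phi> ` U)"
proof -
  have "chart_of M (U, \<phi>)"
    using manifold assms by (simp add: smooth_manifold_def)
  then show "U \<subseteq> topspace M" "open (\<phi> ` U)"
    by (simp_all add: chart_of_def openin_subset)
qed

lemma smooth_funs_iff:
  "f \<in> smooth_funs \<A> \<longleftrightarrow>
    (\<forall>U \<phi> k. (U, \<phi>) \<in> \<A> \<longrightarrow> Ck_on k (\<lambda>x. f (inv_into U \<phi> x)) (\<phi> ` U))"
  unfolding smooth_funs_def smooth_on_def o_def by blast

text \<open>On a chart image, \<open>inv_into\<close> returns points of the chart domain, which lies
  inside the manifold, so values elsewhere are never seen.\<close>

lemma smooth_funs_cong:
  assumes "f \<in> smooth_funs \<A>" "\<And>p. p \<in> topspace M \<Longrightarrow> f p = h p"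
  shows "h \<in> smooth_funs \<A>"
  unfolding smooth_funs_iff
proof (intro allI impI)
  fix U \<phi> k assume c: "(U, \<phi>) \<in> \<A>"
  show "Ck_on k (\<lambda>x. h (inv_into U \<phi> x)) (\<phi> ` U)"
  proof (rule Ck_on_cong[OF chart(2)[OF c]])
    show "Ck_on k (\<lambda>x. f (inv_into U \<phi> x)) (\<phi> ` U)"
      using assms(1) c unfolding smooth_funs_iff by blast
    fix x assume "x \<in> \<phi> ` U"
    then have "inv_into U \<phi> x \<in> U"
      by (rule inv_into_into)
    then show "f (inv_into U \<phi> x) = h (inv_into U \<phi> x)"
      using chart(1)[OF c] by (intro assms(2)) (rule subsetD)
  qed
qed

lemma smooth_funs_const [simp]: "(\<lambda>p. c) \<in> smooth_funs \<A>"
  unfolding smooth_funs_iff by (intro allI impI Ck_on_const)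

lemma smooth_funs_add:
  "f \<in> smooth_funs \<A> \<Longrightarrow> h \<in> smooth_funs \<A> \<Longrightarrow> (\<lambda>p. f p + h p) \<in> smooth_funs \<A>"
  unfolding smooth_funs_iff by (intro allI impI Ck_on_add chart(2)) blast+

lemma smooth_funs_mult:
  "f \<in> smooth_funs \<A> \<Longrightarrow> h \<in> smooth_funs \<A> \<Longrightarrow> (\<lambda>p. f p * h p) \<in> smooth_funs \<A>"
  unfolding smooth_funs_iff by (intro allI impI Ck_on_mult chart(2)) blast+

lemma smooth_funs_diff:
  assumes "f \<in> smooth_funs \<A>" "h \<in> smooth_funs \<A>"
  shows "(\<lambda>p. f p - h p) \<in> smooth_funs \<A>"
  using smooth_funs_add[OF assms(1) smooth_funs_mult[OF smooth_funs_const[of "-1"] assms(2)]]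
  by simp

section \<open>Derivations at a point\<close>

lemma tangent_add:
  "v \<in> tangent_space \<A> q \<Longrightarrow> f \<in> smooth_funs \<A> \<Longrightarrow> h \<in> smooth_funs \<A> \<Longrightarrow>
    v (\<lambda>p. f p + h p) = v f + v h"
  by (auto simp: tangent_space_def)

lemma tangent_scale:
  "v \<in> tangent_space \<A> q \<Longrightarrow> f \<in> smooth_funs \<A> \<Longrightarrow> v (\<lambda>p. c * f p) = c * v f"
  by (auto simp: tangent_space_def)

lemma tangent_mult:
  "v \<in> tangent_space \<A> q \<Longrightarrow> f \<in> smooth_funs \<A> \<Longrightarrow> h \<in> smooth_funs \<A> \<Longrightarrow>
    v (\<lambda>p. f p * h p) = f q * v h + h q * v f"
  by (auto simp: tangent_space_def)

text \<open>The Leibniz rule on \<open>1 * 1\<close> gives \<open>v 1 = 2 * v 1\<close>, so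
  \<open>v\<close> kills 1 and, by homogeneity, every constant.\<close>

lemma tangent_const:
  assumes "v \<in> tangent_space \<A> q"
  shows "v (\<lambda>p. c) = 0"
  using tangent_mult[OF assms, of "\<lambda>p. 1" "\<lambda>p. 1"]
    tangent_scale[OF assms, of "\<lambda>p. 1" c] by simp

lemma tangent_cong:
  assumes v: "v \<in> tangent_space \<A> q" and q: "q \<in> topspace M"
    and eq: "\<And>p. p \<in> topspace M \<Longrightarrow> f p = h p"
  shows "v f = v h"
proof (cases "f \<in> smooth_funs \<A>")
  case True
  then have h: "h \<in> smooth_funs \<A>"
    using smooth_funs_cong[of f h] eq by blast
  define d where "d = (\<lambda>p. f p - h p)"
  \<comment> \<open>Smooth because it is zero on the manifold, and equal to 1 wherever
    \<open>d\<close> may be nonzero. Hence \<open>d\<close> is the product \<open>d * i\<close> of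
    two smooth functions vanishing at \<open>q\<close>, which a derivation kills.\<close>
  define i where "i p = (if p \<in> topspace M then 0 else 1 :: real)" for p
  have d: "d \<in> smooth_funs \<A>"
    unfolding d_def using True h by (rule smooth_funs_diff)
  have i: "i \<in> smooth_funs \<A>"
    by (rule smooth_funs_cong[of "\<lambda>p. 0"]) (simp_all add: i_def)
  have "d = (\<lambda>p. d p * i p)"
    by (auto simp: fun_eq_iff d_def i_def eq)
  then have "v d = d q * v i + i q * v d"
    using tangent_mult[OF v d i] by metis
  then have "v d = 0"
    using q by (simp add: d_def i_def eq)
  moreover have "f = (\<lambda>p. h p + d p)"
    by (simp add: d_def)
  then have "v f = v h + v d"
    using tangent_add[OF v h d] by simp
  ultimately show ?thesis by simp
next
  case False
  \<comment> \<open>Smoothness depends only on the values on the manifold, so both functions are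
    nonsmooth and \<open>v\<close> is normalised to 0 on each.\<close>
  then have "h \<notin> smooth_funs \<A>"
    using smooth_funs_cong[of h f] eq by metis
  then show ?thesis using False v by (auto simp: tangent_space_def)
qed

lemma subspace_tangent_space: "subspace (tangent_space \<A> q)"
  unfolding subspace_def
proof (intro conjI ballI allI)
  show "0 \<in> tangent_space \<A> q"
    by (simp add: tangent_space_def)
  fix v w assume "v \<in> tangent_space \<A> q" "w \<in> tangent_space \<A> q"
  then show "v + w \<in> tangent_space \<A> q"
    by (simp add: tangent_space_def algebra_simps)
next
  fix c v assume "v \<in> tangent_space \<A> q"
  then show "c *\<^sub>R v \<in> tangent_space \<A> q"
    by (simp add: tangent_space_def scaleR_fun_def algebra_simps)
qed

section \<open>Derivatives along vector fields, and vector fields as a module over the smooth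
  functions\<close>

lemma vector_fields_at: "X \<in> vector_fields M \<A> \<Longrightarrow> q \<in> topspace M \<Longrightarrow> X q \<in> tangent_space \<A> q"
  by (simp add: vector_fields_def)

lemma along_smooth:
  "X \<in> vector_fields M \<A> \<Longrightarrow> f \<in> smooth_funs \<A> \<Longrightarrow> along X f \<in> smooth_funs \<A>"
  by (simp add: vector_fields_def)

lemma along_cong:
  assumes "X \<in> vector_fields M \<A>" "q \<in> topspace M" "\<And>p. p \<in> topspace M \<Longrightarrow> f p = h p"
  shows "along X f q = along X h q"
  using tangent_cong[OF vector_fields_at] assms by (simp add: along_def)

lemma along_const:
  "X \<in> vector_fields M \<A> \<Longrightarrow> q \<in> topspace M \<Longrightarrow> along X (\<lambda>p. c) q = 0"
  using tangent_const[OF vector_fields_at] by (simp add: along_def)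

lemma along_add:
  "X \<in> vector_fields M \<A> \<Longrightarrow> q \<in> topspace M \<Longrightarrow> f \<in> smooth_funs \<A> \<Longrightarrow> h \<in> smooth_funs \<A> \<Longrightarrow>
    along X (\<lambda>p. f p + h p) q = along X f q + along X h q"
  using tangent_add[OF vector_fields_at] by (simp add: along_def)

lemma along_scale:
  "X \<in> vector_fields M \<A> \<Longrightarrow> q \<in> topspace M \<Longrightarrow> f \<in> smooth_funs \<A> \<Longrightarrow>
    along X (\<lambda>p. c * f p) q = c * along X f q"
  using tangent_scale[OF vector_fields_at] by (simp add: along_def)

lemma vector_fields_cong:
  assumes "X \<in> vector_fields M \<A>" "\<And>q. q \<in> topspace M \<Longrightarrow> X q = Y q"
  shows "Y \<in> vector_fields M \<A>"
  using assms smooth_funs_cong[of "along X f" "along Y f" for f]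
  by (auto simp: vector_fields_def along_def)

lemma vector_fields_add:
  assumes "X \<in> vector_fields M \<A>" "Y \<in> vector_fields M \<A>"
  shows "(\<lambda>q. X q + Y q) \<in> vector_fields M \<A>"
  using assms smooth_funs_add[of "along X f" "along Y f" for f]
  by (auto simp: vector_fields_def along_def intro: subspace_add[OF subspace_tangent_space])

lemma vector_fields_scale:
  assumes f: "f \<in> smooth_funs \<A>" and X: "X \<in> vector_fields M \<A>"
  shows "(\<lambda>q. f q *\<^sub>R X q) \<in> vector_fields M \<A>"
proof -
  have "along (\<lambda>q. f q *\<^sub>R X q) h = (\<lambda>q. f q * along X h q)" for h
    by (simp add: along_def scaleR_fun_def)
  then show ?thesis
    using smooth_funs_mult[OF f along_smooth[OF X]]
    by (simp add: vector_fields_def subspace_scale[OF subspace_tangent_space] vector_fields_at[OF X])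
qed

lemma vector_fields_diff:
  assumes "X \<in> vector_fields M \<A>" "Y \<in> vector_fields M \<A>"
  shows "(\<lambda>q. X q - Y q) \<in> vector_fields M \<A>"
  using vector_fields_add[OF assms(1) vector_fields_scale[of "\<lambda>q. -1", OF _ assms(2)]] by simp

end


section \<open>The curvature tensor\<close>

locale levi_civita_mfd = smooth_mfd +
  fixes g :: "'a metric_tensor" and D :: "'a conn"
  assumes metric: "lorentzian_metric M \<A> g"
    and levi_civita: "levi_civita M \<A> g D"
begin

abbreviation "VF \<equiv> vector_fields M \<A>"
abbreviation "T q \<equiv> tangent_space \<A> q"

section \<open>Algebra of the metric and of the connection\<close>

lemma metric_linear_left:
  "q \<in> topspace M \<Longrightarrow> u \<in> T q \<Longrightarrow> v \<in> T q \<Longrightarrow> w \<in> T q \<Longrightarrow>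
    g q (c *\<^sub>R u + d *\<^sub>R v) w = c * g q u w + d * g q v w"
  using metric by (simp add: lorentzian_metric_def)

lemma metric_sym: "q \<in> topspace M \<Longrightarrow> v \<in> T q \<Longrightarrow> w \<in> T q \<Longrightarrow> g q v w = g q w v"
  using metric by (simp add: lorentzian_metric_def)

lemma metric_nondegenerate:
  "q \<in> topspace M \<Longrightarrow> v \<in> T q \<Longrightarrow> (\<And>w. w \<in> T q \<Longrightarrow> g q v w = 0) \<Longrightarrow> v = 0"
  using metric by (simp add: lorentzian_metric_def)

lemma metric_smooth: "V \<in> VF \<Longrightarrow> W \<in> VF \<Longrightarrow> (\<lambda>q. g q (V q) (W q)) \<in> smooth_funs \<A>"
  using metric by (simp add: lorentzian_metric_def)

lemma metric_linear_right:
  assumes "q \<in> topspace M" "u \<in> T q" "v \<in> T q" "w \<in> T q"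
  shows "g q w (c *\<^sub>R u + d *\<^sub>R v) = c * g q w u + d * g q w v"
proof -
  have "c *\<^sub>R u + d *\<^sub>R v \<in> T q"
    using assms subspace_tangent_space by (simp add: subspace_add subspace_scale)
  then show ?thesis
    using metric_sym[of q w] metric_linear_left[of q u v w c d] assms by simp
qed

lemma metric_diff_left:
  "q \<in> topspace M \<Longrightarrow> u \<in> T q \<Longrightarrow> v \<in> T q \<Longrightarrow> w \<in> T q \<Longrightarrow>
    g q (u - v) w = g q u w - g q v w"
  using metric_linear_left[of q u v w 1 "-1"] by simp

lemma metric_scale_left:
  "q \<in> topspace M \<Longrightarrow> u \<in> T q \<Longrightarrow> w \<in> T q \<Longrightarrow> g q (c *\<^sub>R u) w = c * g q u w"
  using metric_linear_left[of q u u w c 0] by simp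

lemma conn_VF: "V \<in> VF \<Longrightarrow> W \<in> VF \<Longrightarrow> D V W \<in> VF"
  using levi_civita by (simp add: levi_civita_def connection_def)

lemma conn_add_left:
  "U \<in> VF \<Longrightarrow> V \<in> VF \<Longrightarrow> W \<in> VF \<Longrightarrow> q \<in> topspace M \<Longrightarrow>
    D (\<lambda>p. U p + V p) W q = D U W q + D V W q"
  using levi_civita by (simp add: levi_civita_def connection_def)

lemma conn_add_right:
  "U \<in> VF \<Longrightarrow> V \<in> VF \<Longrightarrow> W \<in> VF \<Longrightarrow> q \<in> topspace M \<Longrightarrow>
    D U (\<lambda>p. V p + W p) q = D U V q + D U W q"
  using levi_civita by (simp add: levi_civita_def connection_def)

lemma conn_scale_left:
  "V \<in> VF \<Longrightarrow> W \<in> VF \<Longrightarrow> f \<in> smooth_funs \<A> \<Longrightarrow> q \<in> topspace M \<Longrightarrow>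
    D (\<lambda>p. f p *\<^sub>R V p) W q = f q *\<^sub>R D V W q"
  using levi_civita by (simp add: levi_civita_def connection_def)

lemma conn_scale_right:
  "V \<in> VF \<Longrightarrow> W \<in> VF \<Longrightarrow> f \<in> smooth_funs \<A> \<Longrightarrow> q \<in> topspace M \<Longrightarrow>
    D V (\<lambda>p. f p *\<^sub>R W p) q = along V f q *\<^sub>R W q + f q *\<^sub>R D V W q"
  using levi_civita by (simp add: levi_civita_def connection_def)

lemma torsion_free:
  "V \<in> VF \<Longrightarrow> W \<in> VF \<Longrightarrow> q \<in> topspace M \<Longrightarrow> lie_bracket V W q = D V W q - D W V q"
  using levi_civita by (simp add: levi_civita_def)

lemma metric_compatible:
  "X \<in> VF \<Longrightarrow> V \<in> VF \<Longrightarrow> W \<in> VF \<Longrightarrow> q \<in> topspace M \<Longrightarrow>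
    along X (\<lambda>p. g p (V p) (W p)) q = g q (D X V q) (W q) + g q (V q) (D X W q)"
  using levi_civita by (simp add: levi_civita_def)

lemma indicator_smooth: "(\<lambda>p. if p \<in> topspace M then 1 else 0) \<in> smooth_funs \<A>"
  by (rule smooth_funs_cong[of "\<lambda>p. 1"]) simp_all

text \<open>Total functions that agree on the manifold may differ elsewhere; multiplication by its
  indicator function identifies them.\<close>

lemma conn_cong_left:
  assumes "U \<in> VF" "V \<in> VF" "W \<in> VF" "q \<in> topspace M"
    and eq: "\<And>p. p \<in> topspace M \<Longrightarrow> U p = V p"
  shows "D U W q = D V W q"
proof -
  let ?i = "\<lambda>p. if p \<in> topspace M then 1 else 0 :: real"
  have "(\<lambda>p. ?i p *\<^sub>R U p) = (\<lambda>p. ?i p *\<^sub>R V p)"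
    using eq by auto
  then have "D (\<lambda>p. ?i p *\<^sub>R U p) W q = D (\<lambda>p. ?i p *\<^sub>R V p) W q"
    by simp
  then show ?thesis
    using conn_scale_left[OF _ \<open>W \<in> VF\<close> indicator_smooth assms(4)] assms(1,2,4) by simp
qed

lemma conn_cong_right:
  assumes "U \<in> VF" "V \<in> VF" "W \<in> VF" "q \<in> topspace M"
    and eq: "\<And>p. p \<in> topspace M \<Longrightarrow> V p = W p"
  shows "D U V q = D U W q"
proof -
  let ?i = "\<lambda>p. if p \<in> topspace M then 1 else 0 :: real"
  \<comment> \<open>On the manifold the indicator is the constant 1, so the Leibniz rule for
    \<open>D U\<close> contributes no derivative term.\<close>
  have "along U ?i q = 0"
    using along_cong[of U q ?i "\<lambda>p. 1"] along_const[of U q 1] assms(1,4) by simp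
  then have "D U (\<lambda>p. ?i p *\<^sub>R X p) q = D U X q" if "X \<in> VF" for X
    using conn_scale_right[OF \<open>U \<in> VF\<close> that indicator_smooth assms(4)] assms(4) by simp
  note indicator = this[OF assms(2)] this[OF assms(3)]
  have "(\<lambda>p. ?i p *\<^sub>R V p) = (\<lambda>p. ?i p *\<^sub>R W p)"
    using eq by auto
  then show ?thesis
    using indicator by simp
qed

lemma conn_diff_left:
  assumes "U \<in> VF" "V \<in> VF" "W \<in> VF" "q \<in> topspace M"
  shows "D (\<lambda>p. U p - V p) W q = D U W q - D V W q"
  using conn_add_left[OF assms(1) vector_fields_scale[of "\<lambda>p. -1", OF _ assms(2)] assms(3,4)]
    conn_scale_left[OF assms(2,3) smooth_funs_const[of "-1"] assms(4)] by simp

text \<open>By vanishing torsion the bracket agrees on the manifold with a difference of two vector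
  fields, so the derivation property of the commutator need not be verified directly.\<close>

lemma lie_bracket_VF: "V \<in> VF \<Longrightarrow> W \<in> VF \<Longrightarrow> lie_bracket V W \<in> VF"
  by (rule vector_fields_cong[OF vector_fields_diff[OF conn_VF[of V W] conn_VF[of W V]]])
    (simp_all add: torsion_free)

section \<open>Linearity and symmetries of the curvature\<close>

lemma riemann_at_tangent:
  "X \<in> VF \<Longrightarrow> Y \<in> VF \<Longrightarrow> Z \<in> VF \<Longrightarrow> q \<in> topspace M \<Longrightarrow> riemann D X Y Z q \<in> T q"
  unfolding riemann_def
  by (intro subspace_diff subspace_tangent_space vector_fields_at conn_VF lie_bracket_VF)

text \<open>Additivity of the bracket is read off from vanishing torsion. The connection axioms give
  equalities only at points of the manifold, while \<open>D\<close> takes whole fields as arguments;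
  the congruence lemmas bridge this here and below.\<close>

lemma riemann_add_left:
  assumes "X \<in> VF" "X' \<in> VF" "Y \<in> VF" "Z \<in> VF" "q \<in> topspace M"
  shows "riemann D (\<lambda>p. X p + X' p) Y Z q = riemann D X Y Z q + riemann D X' Y Z q"
proof -
  let ?S = "\<lambda>p. X p + X' p"
  have S: "?S \<in> VF"
    using assms by (intro vector_fields_add)
  have "lie_bracket ?S Y p = lie_bracket X Y p + lie_bracket X' Y p" if "p \<in> topspace M" for p
    using assms that S by (simp add: torsion_free conn_add_left conn_add_right)
  then have "D (lie_bracket ?S Y) Z q = D (\<lambda>p. lie_bracket X Y p + lie_bracket X' Y p) Z q"
    using assms S by (intro conn_cong_left lie_bracket_VF vector_fields_add)
  moreover have "D Y (D ?S Z) q = D Y (\<lambda>p. D X Z p + D X' Z p) q"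
    using assms S by (intro conn_cong_right conn_VF vector_fields_add conn_add_left)
  ultimately show ?thesis
    using assms by (simp add: riemann_def conn_add_left conn_add_right conn_VF lie_bracket_VF)
qed

text \<open>With \<open>[f X, Y] = f [X, Y] - (Y f) X\<close>, the bracket contributes
  \<open>- (Y f) D X Z\<close>, which cancels the Leibniz term of \<open>D Y\<close> applied to
  \<open>f D X Z\<close>.\<close>

lemma riemann_scale_left:
  assumes "f \<in> smooth_funs \<A>" "X \<in> VF" "Y \<in> VF" "Z \<in> VF" "q \<in> topspace M"
  shows "riemann D (\<lambda>p. f p *\<^sub>R X p) Y Z q = f q *\<^sub>R riemann D X Y Z q"
proof -
  let ?S = "\<lambda>p. f p *\<^sub>R X p"
  let ?B = "\<lambda>p. f p *\<^sub>R lie_bracket X Y p - along Y f p *\<^sub>R X p"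
  have S: "?S \<in> VF"
    using assms by (intro vector_fields_scale)
  have Yf: "along Y f \<in> smooth_funs \<A>"
    using assms by (intro along_smooth)
  have VF: "(\<lambda>p. f p *\<^sub>R lie_bracket X Y p) \<in> VF" "(\<lambda>p. along Y f p *\<^sub>R X p) \<in> VF"
    using assms Yf by (simp_all add: vector_fields_scale lie_bracket_VF)
  have "lie_bracket ?S Y p = ?B p" if "p \<in> topspace M" for p
    using assms that S
    by (simp add: torsion_free conn_scale_left conn_scale_right algebra_simps)
  then have "D (lie_bracket ?S Y) Z q = D ?B Z q"
    using assms S VF by (intro conn_cong_left lie_bracket_VF vector_fields_diff)
  also have "\<dots> = f q *\<^sub>R D (lie_bracket X Y) Z q - along Y f q *\<^sub>R D X Z q"
    using assms VF Yf by (simp add: conn_diff_left conn_scale_left lie_bracket_VF)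
  finally have 1: "D (lie_bracket ?S Y) Z q = \<dots>" .
  have "D Y (D ?S Z) q = D Y (\<lambda>p. f p *\<^sub>R D X Z p) q"
    using assms S by (intro conn_cong_right conn_VF vector_fields_scale conn_scale_left)
  also have "\<dots> = along Y f q *\<^sub>R D X Z q + f q *\<^sub>R D Y (D X Z) q"
    using assms by (intro conn_scale_right conn_VF)
  finally show ?thesis
    using assms 1 by (simp add: riemann_def conn_scale_left conn_VF algebra_simps)
qed

lemma riemann_antisym:
  assumes "X \<in> VF" "Y \<in> VF" "Z \<in> VF" "q \<in> topspace M"
  shows "riemann D X Y Z q = - riemann D Y X Z q"
proof -
  have "D (lie_bracket X Y) Z q = D (\<lambda>p. -1 *\<^sub>R lie_bracket Y X p) Z q"
    using assms by (intro conn_cong_left lie_bracket_VF vector_fields_scale) (simp_all add: torsion_free)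
  also have "\<dots> = - D (lie_bracket Y X) Z q"
    using conn_scale_left[OF lie_bracket_VF[of Y X] _ smooth_funs_const[of "-1"]] assms by simp
  finally show ?thesis by (simp add: riemann_def)
qed

lemma riemann_add_right:
  assumes "X \<in> VF" "Y \<in> VF" "Z \<in> VF" "Z' \<in> VF" "q \<in> topspace M"
  shows "riemann D X Y (\<lambda>p. Z p + Z' p) q = riemann D X Y Z q + riemann D X Y Z' q"
proof -
  have "D U (D V (\<lambda>p. Z p + Z' p)) q = D U (D V Z) q + D U (D V Z') q"
    if "U \<in> VF" "V \<in> VF" for U V
  proof -
    have "D U (D V (\<lambda>p. Z p + Z' p)) q = D U (\<lambda>p. D V Z p + D V Z' p) q"
      using assms that by (intro conn_cong_right conn_VF vector_fields_add conn_add_right)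
    then show ?thesis
      using assms that by (simp add: conn_add_right conn_VF)
  qed
  then show ?thesis
    using assms by (simp add: riemann_def conn_add_right lie_bracket_VF)
qed

text \<open>The terms with first derivatives of \<open>f\<close> coming from two covariant
  derivatives are symmetric in \<open>X\<close> and \<open>Y\<close>, so they cancel in the
  commutator. The second derivatives combine to \<open>[X, Y] f\<close>, which cancels the Leibniz
  term of \<open>D (lie_bracket X Y)\<close>.\<close>

lemma riemann_scale_right:
  assumes "f \<in> smooth_funs \<A>" "X \<in> VF" "Y \<in> VF" "Z \<in> VF" "q \<in> topspace M"
  shows "riemann D X Y (\<lambda>p. f p *\<^sub>R Z p) q = f q *\<^sub>R riemann D X Y Z q"
proof -
  have 1: "D U (D V (\<lambda>p. f p *\<^sub>R Z p)) q =
      along U (along V f) q *\<^sub>R Z q + along V f q *\<^sub>R D U Z q +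
      (along U f q *\<^sub>R D V Z q + f q *\<^sub>R D U (D V Z) q)"
    if "U \<in> VF" "V \<in> VF" for U V
  proof -
    have VF: "(\<lambda>p. along V f p *\<^sub>R Z p) \<in> VF" "(\<lambda>p. f p *\<^sub>R D V Z p) \<in> VF"
      using assms that by (simp_all add: vector_fields_scale along_smooth conn_VF)
    have "D U (D V (\<lambda>p. f p *\<^sub>R Z p)) q = D U (\<lambda>p. along V f p *\<^sub>R Z p + f p *\<^sub>R D V Z p) q"
      using assms that VF
      by (intro conn_cong_right conn_VF vector_fields_add vector_fields_scale conn_scale_right along_smooth)
    then show ?thesis
      using assms that VF by (simp add: conn_add_right conn_scale_right conn_VF along_smooth)
  qed
  have 2: "along (lie_bracket X Y) f q = along X (along Y f) q - along Y (along X f) q"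
    by (simp add: along_def lie_bracket_def)
  show ?thesis
    using assms by (simp add: riemann_def conn_scale_right lie_bracket_VF 1 2 algebra_simps)
qed

text \<open>The bracket acts on the function \<open>g(V, W)\<close> as the commutator of
  derivatives. Expanding both sides by metric compatibility, the mixed terms are symmetric in
  \<open>X\<close> and \<open>Y\<close> and drop out; what remains says that the curvature operator
  is skew.\<close>

lemma riemann_skew_adjoint:
  assumes "X \<in> VF" "Y \<in> VF" "V \<in> VF" "W \<in> VF" "q \<in> topspace M"
  shows "g q (riemann D X Y V q) (W q) = - g q (V q) (riemann D X Y W q)"
proof -
  let ?h = "\<lambda>p. g p (V p) (W p)"
  have 1: "along X' (along Y' ?h) q =
      g q (D X' (D Y' V) q) (W q) + g q (D Y' V q) (D X' W q) +
      (g q (D X' V q) (D Y' W q) + g q (V q) (D X' (D Y' W) q))"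
    if "X' \<in> VF" "Y' \<in> VF" for X' Y'
  proof -
    have "along X' (along Y' ?h) q =
        along X' (\<lambda>p. g p (D Y' V p) (W p) + g p (V p) (D Y' W p)) q"
      using assms that by (intro along_cong metric_compatible)
    then show ?thesis
      using assms that by (simp add: along_add metric_smooth conn_VF metric_compatible)
  qed
  have "along (lie_bracket X Y) ?h q = along X (along Y ?h) q - along Y (along X ?h) q"
    by (simp add: along_def lie_bracket_def)
  then have 2: "g q (D (lie_bracket X Y) V q) (W q) + g q (V q) (D (lie_bracket X Y) W q) =
      g q (D X (D Y V) q) (W q) - g q (D Y (D X V) q) (W q) +
      (g q (V q) (D X (D Y W) q) - g q (V q) (D Y (D X W) q))"
    using assms by (simp add: metric_compatible lie_bracket_VF 1)
  have T: "U q \<in> T q" if "U \<in> VF" for U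
    using that assms(5) by (rule vector_fields_at)
  have 3: "g q (riemann D X Y U q) (U' q) =
      g q (D (lie_bracket X Y) U q) (U' q) - (g q (D X (D Y U) q) (U' q) - g q (D Y (D X U) q) (U' q))"
    if "U \<in> VF" "U' \<in> VF" for U U'
    using assms that
    by (simp add: riemann_def metric_diff_left T conn_VF lie_bracket_VF subspace_diff subspace_tangent_space)
  \<comment> \<open>Moving \<open>V q\<close> to the second slot lets linearity in the first slot
    serve both sides of the claim.\<close>
  have 4: "g q (V q) (U q) = g q (U q) (V q)" if "U \<in> VF" for U
    using assms that T by (intro metric_sym)
  have 5: "g q (V q) (riemann D X Y W q) = g q (riemann D X Y W q) (V q)"
    using assms T riemann_at_tangent by (intro metric_sym)
  have VF: "D (lie_bracket X Y) W \<in> VF" "D X (D Y W) \<in> VF" "D Y (D X W) \<in> VF"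
    using assms by (simp_all add: conn_VF lie_bracket_VF)
  show ?thesis
    using 2 unfolding 5 3[OF assms(3,4)] 3[OF assms(4,3)] 4[OF VF(1)] 4[OF VF(2)] 4[OF VF(3)]
    by linarith
qed

end


section \<open>Frames with constant inner products\<close>

locale constant_frame = levi_civita_mfd +
  fixes X1 X2 :: "'a vfield" and a11 a12 a22 :: real
  assumes X1: "X1 \<in> VF" and X2: "X2 \<in> VF"
    and frame: "\<And>q. q \<in> topspace M \<Longrightarrow> is_basis (X1 q) (X2 q) (T q)"
    and g11: "\<And>q. q \<in> topspace M \<Longrightarrow> g q (X1 q) (X1 q) = a11"
    and g12: "\<And>q. q \<in> topspace M \<Longrightarrow> g q (X1 q) (X2 q) = a12"
    and g22: "\<And>q. q \<in> topspace M \<Longrightarrow> g q (X2 q) (X2 q) = a22"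
begin

text \<open>The Gram determinant of the frame, equal to the determinant of the matrix in the
  theorem.\<close>

abbreviation "\<delta> \<equiv> a11 * a22 - a12\<^sup>2"

section \<open>Linear algebra of the frame\<close>

lemma frame_tangent: "q \<in> topspace M \<Longrightarrow> X1 q \<in> T q" "q \<in> topspace M \<Longrightarrow> X2 q \<in> T q"
  using X1 X2 by (simp_all add: vector_fields_at)

lemma g21: "q \<in> topspace M \<Longrightarrow> g q (X2 q) (X1 q) = a12"
  using metric_sym[of q "X2 q" "X1 q"] frame_tangent g12 by simp

lemma frame_coordinates:
  assumes "q \<in> topspace M" "v \<in> T q"
  obtains \<alpha> \<beta> where "v = \<alpha> *\<^sub>R X1 q + \<beta> *\<^sub>R X2 q"
proof -
  have "v \<in> span {X1 q, X2 q}"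
    using frame[OF assms(1)] assms(2) by (simp add: is_basis_def)
  then obtain \<alpha> where "v - \<alpha> *\<^sub>R X1 q \<in> span {X2 q}"
    by (auto simp: span_insert)
  then obtain \<beta> where "v - \<alpha> *\<^sub>R X1 q = \<beta> *\<^sub>R X2 q"
    by (auto simp: span_singleton)
  then have "v = \<alpha> *\<^sub>R X1 q + \<beta> *\<^sub>R X2 q"
    by (simp add: algebra_simps)
  then show ?thesis by (rule that)
qed

lemma frame_combination:
  "q \<in> topspace M \<Longrightarrow> \<alpha> *\<^sub>R X1 q + \<beta> *\<^sub>R X2 q \<in> T q"
  by (intro subspace_add subspace_scale subspace_tangent_space frame_tangent)

lemma metric_frame:
  assumes "q \<in> topspace M"
  shows "g q (\<alpha> *\<^sub>R X1 q + \<beta> *\<^sub>R X2 q) (X1 q) = \<alpha> * a11 + \<beta> * a12"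
    and "g q (\<alpha> *\<^sub>R X1 q + \<beta> *\<^sub>R X2 q) (X2 q) = \<alpha> * a12 + \<beta> * a22"
  using assms by (simp_all add: metric_linear_left frame_tangent g11 g12 g21 g22)

lemma metric_frame_frame:
  assumes "q \<in> topspace M"
  shows "g q (\<alpha> *\<^sub>R X1 q + \<beta> *\<^sub>R X2 q) (\<gamma> *\<^sub>R X1 q + \<epsilon> *\<^sub>R X2 q) =
    \<gamma> * (\<alpha> * a11 + \<beta> * a12) + \<epsilon> * (\<alpha> * a12 + \<beta> * a22)"
  using assms by (simp add: metric_linear_right frame_combination frame_tangent metric_frame)

lemma frame_independent:
  assumes "q \<in> topspace M" "\<alpha> *\<^sub>R X1 q + \<beta> *\<^sub>R X2 q = 0"
  shows "\<alpha> = 0 \<and> \<beta> = 0"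
proof -
  have "X1 q \<noteq> X2 q" "independent {X1 q, X2 q}"
    using frame[OF assms(1)] by (auto simp: is_basis_def)
  then show ?thesis
    using independentD[of "{X1 q, X2 q}" "{X1 q, X2 q}" "\<lambda>x. if x = X1 q then \<alpha> else \<beta>"] assms(2)
    by (force split: if_splits)
qed

text \<open>A kernel vector of the Gram matrix is the coordinate vector of a tangent vector
  orthogonal to everything, which nondegeneracy forces to be zero.\<close>

lemma gram_det_nonzero:
  assumes q: "q \<in> topspace M"
  shows "\<delta> \<noteq> 0"
proof
  assume \<delta>: "\<delta> = 0"
  have orth: "\<alpha> = 0 \<and> \<beta> = 0"
    if "\<alpha> * a11 + \<beta> * a12 = 0" "\<alpha> * a12 + \<beta> * a22 = 0" for \<alpha> \<beta>
  proof (rule frame_independent[OF q], rule metric_nondegenerate[OF q frame_combination[OF q]])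
    fix w assume "w \<in> T q"
    then obtain \<gamma> \<epsilon> where "w = \<gamma> *\<^sub>R X1 q + \<epsilon> *\<^sub>R X2 q"
      using frame_coordinates[OF q] by blast
    then show "g q (\<alpha> *\<^sub>R X1 q + \<beta> *\<^sub>R X2 q) w = 0"
      using that by (simp add: metric_frame_frame[OF q])
  qed
  \<comment> \<open>\<open>(- a12, a11)\<close> is orthogonal to the first row of the Gram matrix,
    and to the second because \<delta> = 0. Once it vanishes, \<open>(1, 0)\<close> lies in the
    kernel as well, which is absurd.\<close>
  have "a12 = 0 \<and> a11 = 0"
    using orth[of "- a12" a11] \<delta> by (simp add: power2_eq_square algebra_simps)
  then show False
    using orth[of 1 0] by simp
qed

text \<open>Cramer's rule for the Gram system. In this form the coefficients are visibly smooth when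
  \<open>v\<close> comes from a smooth field.\<close>

lemma frame_expansion:
  assumes q: "q \<in> topspace M" and v: "v \<in> T q"
  shows "v = ((a22 * g q v (X1 q) - a12 * g q v (X2 q)) / \<delta>) *\<^sub>R X1 q +
             ((a11 * g q v (X2 q) - a12 * g q v (X1 q)) / \<delta>) *\<^sub>R X2 q"
proof -
  obtain \<alpha> \<beta> where v: "v = \<alpha> *\<^sub>R X1 q + \<beta> *\<^sub>R X2 q"
    using frame_coordinates[OF q v] .
  have "(a22 * g q v (X1 q) - a12 * g q v (X2 q)) / \<delta> = \<alpha>"
    "(a11 * g q v (X2 q) - a12 * g q v (X1 q)) / \<delta> = \<beta>"
    unfolding v metric_frame[OF q] using gram_det_nonzero[OF q]
    by (simp_all add: divide_simps) (algebra+)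
  then show ?thesis
    using v by simp
qed

text \<open>The inverse of the Gram matrix expresses \<open>g\<close> through inner products with
  the frame; multiplying by \<delta> leaves a polynomial identity.\<close>

lemma metric_expansion:
  assumes q: "q \<in> topspace M" and "u \<in> T q" "v \<in> T q"
  shows "\<delta> * g q u v = a22 * g q u (X1 q) * g q v (X1 q)
    - a12 * (g q u (X1 q) * g q v (X2 q) + g q u (X2 q) * g q v (X1 q))
    + a11 * g q u (X2 q) * g q v (X2 q)"
proof -
  obtain \<alpha> \<beta> \<gamma> \<epsilon>
    where uv: "u = \<alpha> *\<^sub>R X1 q + \<beta> *\<^sub>R X2 q" "v = \<gamma> *\<^sub>R X1 q + \<epsilon> *\<^sub>R X2 q"
    using frame_coordinates[OF q assms(2)] frame_coordinates[OF q assms(3)] by metis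
  show ?thesis
    unfolding uv metric_frame_frame[OF q] metric_frame[OF q] by algebra
qed

section \<open>Pointwise curvature and sectional curvature\<close>

text \<open>Linearity over smooth functions reduces \<open>F U\<close> to \<open>F X1\<close> and
  \<open>F X2\<close>, with coefficients that depend on \<open>U\<close> at \<open>q\<close>
  only.\<close>

lemma tensorial_value:
  fixes F :: "'a vfield \<Rightarrow> 'a tvec"
  assumes add: "\<And>U V. U \<in> VF \<Longrightarrow> V \<in> VF \<Longrightarrow> F (\<lambda>p. U p + V p) = F U + F V"
    and scale: "\<And>f V. f \<in> smooth_funs \<A> \<Longrightarrow> V \<in> VF \<Longrightarrow> F (\<lambda>p. f p *\<^sub>R V p) = f q *\<^sub>R F V"
    and q: "q \<in> topspace M" and V: "V \<in> VF" and W: "W \<in> VF" and eq: "V q = W q"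
  shows "F V = F W"
proof -
  \<comment> \<open>The frame expansion of a field holds only on the manifold; multiplied by
    \<open>i\<close> it becomes an equality of total functions, to which \<open>F\<close> can be
    applied. At \<open>q\<close> the factor is 1.\<close>
  define i where "i p = (if p \<in> topspace M then 1 else 0 :: real)" for p
  define f where
    "f U = (\<lambda>p. (a22 / \<delta>) * g p (U p) (X1 p) - (a12 / \<delta>) * g p (U p) (X2 p))" for U
  define h where
    "h U = (\<lambda>p. (a11 / \<delta>) * g p (U p) (X2 p) - (a12 / \<delta>) * g p (U p) (X1 p))" for U
  have i: "i \<in> smooth_funs \<A>"
    using indicator_smooth by (simp add: i_def[abs_def])
  have expand: "F U = f U q *\<^sub>R F X1 + h U q *\<^sub>R F X2" if U: "U \<in> VF" for U
  proof -
    have "f U \<in> smooth_funs \<A>"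
      unfolding f_def by (intro smooth_funs_diff smooth_funs_mult smooth_funs_const metric_smooth U X1 X2)
    moreover have "h U \<in> smooth_funs \<A>"
      unfolding h_def by (intro smooth_funs_diff smooth_funs_mult smooth_funs_const metric_smooth U X1 X2)
    ultimately have smooth:
      "(\<lambda>p. i p * f U p) \<in> smooth_funs \<A>" "(\<lambda>p. i p * h U p) \<in> smooth_funs \<A>"
      by (simp_all add: smooth_funs_mult i)
    have "U p = f U p *\<^sub>R X1 p + h U p *\<^sub>R X2 p" if "p \<in> topspace M" for p
    proof -
      have "f U p = (a22 * g p (U p) (X1 p) - a12 * g p (U p) (X2 p)) / \<delta>"
        "h U p = (a11 * g p (U p) (X2 p) - a12 * g p (U p) (X1 p)) / \<delta>"
        by (simp_all add: f_def h_def diff_divide_distrib)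
      then show ?thesis
        using frame_expansion[OF that vector_fields_at[OF U that]] by metis
    qed
    then have "i p *\<^sub>R U p = (i p * f U p) *\<^sub>R X1 p + (i p * h U p) *\<^sub>R X2 p" for p
      by (simp add: i_def)
    then have "i q *\<^sub>R F U = F (\<lambda>p. (i p * f U p) *\<^sub>R X1 p + (i p * h U p) *\<^sub>R X2 p)"
      using scale[OF i U] by simp
    also have "\<dots> = (i q * f U q) *\<^sub>R F X1 + (i q * h U q) *\<^sub>R F X2"
      using smooth X1 X2 add scale vector_fields_scale by simp
    finally show ?thesis
      using q by (simp add: i_def)
  qed
  have "f V q = f W q" "h V q = h W q"
    by (simp_all add: f_def h_def eq)
  then show ?thesis
    using expand[OF V] expand[OF W] by simp
qed

text \<open>Any extensions can be replaced by \<open>X\<close>, \<open>Y\<close>, \<open>Z\<close>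
  one slot at a time, so the description has a value; it is unique because \<open>X\<close>,
  \<open>Y\<close>, \<open>Z\<close> are themselves extensions.\<close>

lemma riemann_at_eq:
  assumes q: "q \<in> topspace M" and X: "X \<in> VF" and Y: "Y \<in> VF" and Z: "Z \<in> VF"
  shows "riemann_at M \<A> D q (X q) (Y q) (Z q) = riemann D X Y Z q"
proof -
  have left: "riemann D U V W q = riemann D U' V W q"
    if "U \<in> VF" "U' \<in> VF" "V \<in> VF" "W \<in> VF" "U q = U' q" for U U' V W
    by (rule tensorial_value[of "\<lambda>U. riemann D U V W q", OF _ _ q])
      (simp_all add: that q riemann_add_left riemann_scale_left)
  have right: "riemann D U V W q = riemann D U V W' q"
    if "U \<in> VF" "V \<in> VF" "W \<in> VF" "W' \<in> VF" "W q = W' q" for U V W W'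
    by (rule tensorial_value[of "\<lambda>W. riemann D U V W q", OF _ _ q])
      (simp_all add: that q riemann_add_right riemann_scale_right)
  have "riemann D X' Y' Z' q = riemann D X Y Z q"
    if "X' \<in> VF" "Y' \<in> VF" "Z' \<in> VF" "X' q = X q" "Y' q = Y q" "Z' q = Z q" for X' Y' Z'
  proof -
    have "riemann D X' Y' Z' q = riemann D X Y' Z' q"
      using that X by (intro left)
    \<comment> \<open>The second slot is handled by swapping it into the first and back.\<close>
    also have "\<dots> = - riemann D Y' X Z' q"
      using that X q by (intro riemann_antisym)
    also have "riemann D Y' X Z' q = riemann D Y X Z' q"
      using that X Y by (intro left)
    also have "- \<dots> = riemann D X Y Z' q"
      using that X Y q riemann_antisym[of X Y Z' q] by simp
    also have "\<dots> = riemann D X Y Z q"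
      using that X Y Z by (intro right)
    finally show ?thesis .
  qed
  note agree = this
  show ?thesis
    unfolding riemann_at_def
  proof (rule the_equality)
    show "\<forall>X'\<in>VF. \<forall>Y'\<in>VF. \<forall>Z'\<in>VF.
        X' q = X q \<and> Y' q = Y q \<and> Z' q = Z q \<longrightarrow> riemann D X' Y' Z' q = riemann D X Y Z q"
      using agree by blast
  next
    fix r assume "\<forall>X'\<in>VF. \<forall>Y'\<in>VF. \<forall>Z'\<in>VF.
        X' q = X q \<and> Y' q = Y q \<and> Z' q = Z q \<longrightarrow> riemann D X' Y' Z' q = r"
    then show "r = riemann D X Y Z q"
      using X Y Z by blast
  qed
qed

text \<open>Let \<Delta> be the determinant taking the frame to another basis. The numerator gains
  one factor \<Delta> from antisymmetry in the first two arguments and another from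
  skew-adjointness, and \<open>Q_form\<close> gains \<Delta> squared, so every basis gives the
  quotient of the frame.\<close>

lemma sectional_curvature_frame:
  assumes q: "q \<in> topspace M"
  shows "sectional_curvature M \<A> g D q (T q) = g q (riemann D X1 X2 X1 q) (X2 q) / \<delta>"
proof -
  define R where "R = riemann D X1 X2"
  have R_tangent: "R X1 q \<in> T q" "R X2 q \<in> T q"
    using q X1 X2 by (simp_all add: R_def riemann_at_tangent)
  have skew: "g q (R V q) (W q) = - g q (R W q) (V q)" if "V \<in> VF" "W \<in> VF" for V W
    using riemann_skew_adjoint[OF X1 X2 that q] metric_sym[OF q, of "R W q" "V q"]
      riemann_at_tangent[OF X1 X2 that(2) q] vector_fields_at[OF that(1) q]
    by (simp add: R_def)
  have R: "g q (R X1 q) (X1 q) = 0" "g q (R X2 q) (X2 q) = 0"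
    "g q (R X2 q) (X1 q) = - g q (R X1 q) (X2 q)"
    using skew[OF X1 X1] skew[OF X2 X2] skew[OF X2 X1] by simp_all
  have "g q (riemann_at M \<A> D q v w v) w / Q_form g q v w = g q (R X1 q) (X2 q) / \<delta>"
    if basis: "is_basis v w (T q)" for v w
  proof -
    have v: "v \<in> T q" and w: "w \<in> T q"
      using basis span_superset[of "{v, w}"] by (auto simp: is_basis_def)
    obtain \<alpha> \<beta> \<gamma> \<epsilon>
      where vw: "v = \<alpha> *\<^sub>R X1 q + \<beta> *\<^sub>R X2 q" "w = \<gamma> *\<^sub>R X1 q + \<epsilon> *\<^sub>R X2 q"
      using frame_coordinates[OF q v] frame_coordinates[OF q w] by metis
    define \<Delta> where "\<Delta> = \<alpha> * \<epsilon> - \<beta> * \<gamma>"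
    \<comment> \<open>\<open>V\<close> and \<open>W\<close> extend \<open>v\<close> and
      \<open>w\<close> with constant coefficients.\<close>
    define V where "V p = \<alpha> *\<^sub>R X1 p + \<beta> *\<^sub>R X2 p" for p
    define W where "W p = \<gamma> *\<^sub>R X1 p + \<epsilon> *\<^sub>R X2 p" for p
    have VF: "(\<lambda>p. c *\<^sub>R X p) \<in> VF" if "X \<in> VF" for c X
      using vector_fields_scale[of "\<lambda>p. c", OF _ that] by simp
    have V: "V \<in> VF" and W: "W \<in> VF"
      unfolding V_def[abs_def] W_def[abs_def] by (intro vector_fields_add VF X1 X2)+
    have "\<Delta> \<noteq> 0"
    proof
      assume "\<Delta> = 0"
      \<comment> \<open>The coefficients come from the adjugate matrix: the two combinations are
        \<Delta> times \<open>X1 q\<close> and \<Delta> times \<open>X2 q\<close>.\<close>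
      then have "\<epsilon> *\<^sub>R v + (- \<beta>) *\<^sub>R w = 0" "(- \<gamma>) *\<^sub>R v + \<alpha> *\<^sub>R w = 0"
        by (simp_all add: vw \<Delta>_def algebra_simps flip: scaleR_left_diff_distrib)
      moreover have "c = 0 \<and> d = 0" if "c *\<^sub>R v + d *\<^sub>R w = 0" for c d
        using basis that independentD[of "{v, w}" "{v, w}" "\<lambda>x. if x = v then c else d"]
        by (force simp: is_basis_def split: if_splits)
      ultimately have "\<alpha> = 0" "\<beta> = 0"
        by (metis neg_equal_0_iff_equal)+
      then have "v = 0"
        using vw by simp
      then show False
        using basis dependent_zero[of "{v, w}"] by (simp add: is_basis_def)
    qed
    have left: "riemann D (\<lambda>p. c *\<^sub>R X1 p + d *\<^sub>R X2 p) Y Z q =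
        c *\<^sub>R riemann D X1 Y Z q + d *\<^sub>R riemann D X2 Y Z q"
      if "Y \<in> VF" "Z \<in> VF" for c d Y Z
      using that q X1 X2 riemann_scale_left[OF smooth_funs_const]
      by (simp add: riemann_add_left VF)
    have right: "R V q = \<alpha> *\<^sub>R R X1 q + \<beta> *\<^sub>R R X2 q"
      unfolding V_def[abs_def] R_def using q X1 X2 riemann_scale_right[OF smooth_funs_const]
      by (simp add: riemann_add_right VF)
    have diag: "riemann D X1 X1 V q = 0" "riemann D X2 X2 V q = 0"
      using riemann_antisym[OF X1 X1 V q] riemann_antisym[OF X2 X2 V q]
      by (metis add.right_inverse scaleR_2 scaleR_eq_0_iff zero_neq_numeral)+
    \<comment> \<open>\<open>W\<close> is expanded in the second slot by antisymmetry; the diagonal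
      term vanishes.\<close>
    have "riemann D X1 W V q = \<epsilon> *\<^sub>R R V q"
      using riemann_antisym[OF X1 W V q] left[OF X1 V, of \<gamma> \<epsilon>] diag
        riemann_antisym[OF X2 X1 V q]
      by (simp add: R_def W_def[symmetric])
    moreover have "riemann D X2 W V q = - \<gamma> *\<^sub>R R V q"
      using riemann_antisym[OF X2 W V q] left[OF X2 V, of \<gamma> \<epsilon>] diag
      by (simp add: R_def W_def[symmetric])
    ultimately have "riemann D V W V q = \<Delta> *\<^sub>R R V q"
      using left[OF W V, of \<alpha> \<beta>] by (simp add: V_def[symmetric] \<Delta>_def algebra_simps)
    moreover have RV: "R V q \<in> T q"
      using riemann_at_tangent[OF X1 X2 V q] by (simp add: R_def)
    moreover have "g q (R V q) w = \<gamma> * g q (R V q) (X1 q) + \<epsilon> * g q (R V q) (X2 q)"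
      unfolding vw using q RV frame_tangent by (intro metric_linear_right)
    \<comment> \<open>In the frame the skew form has zero diagonal and opposite off-diagonal
      entries, so it is \<Delta> times its single entry.\<close>
    then have "g q (R V q) w = \<Delta> * g q (R X1 q) (X2 q)"
      unfolding right using R q R_tangent frame_tangent
      by (simp add: metric_linear_left \<Delta>_def algebra_simps)
    moreover note w
    ultimately have "g q (riemann D V W V q) w = \<Delta>\<^sup>2 * g q (R X1 q) (X2 q)"
      by (simp add: metric_scale_left q power2_eq_square)
    moreover have "Q_form g q v w = \<Delta>\<^sup>2 * \<delta>"
      unfolding Q_form_def vw metric_frame_frame[OF q] \<Delta>_def by algebra
    moreover have "riemann_at M \<A> D q v w v = riemann D V W V q"
      using riemann_at_eq[OF q V W V] by (simp add: V_def W_def vw)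
    ultimately show ?thesis
      using \<open>\<Delta> \<noteq> 0\<close> by simp
  qed
  then show ?thesis
    \<comment> \<open>The frame is itself a basis, which makes the common value unique.\<close>
    unfolding sectional_curvature_def R_def[symmetric] using frame[OF q]
    by (intro the_equality) auto
qed

text \<open>Metric compatibility turns each second covariant derivative, paired with
  \<open>X2\<close>, into a derivative of \<open>A\<close> or \<open>B\<close> and a product of
  first derivatives. By \<open>cross\<close> the two products are equal and cancel in the
  commutator.\<close>

lemma curvature_structure_functions:
  assumes structure_funs: "\<And>p. p \<in> topspace M \<Longrightarrow>
      lie_bracket X1 X2 p = c1 p *\<^sub>R X1 p + c2 p *\<^sub>R X2 p"
    and c1: "c1 \<in> smooth_funs \<A>" and c2: "c2 \<in> smooth_funs \<A>"
    and A: "\<And>p. A p = a11 * c1 p + a12 * c2 p"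
    and B: "\<And>p. B p = a12 * c1 p + a22 * c2 p"
    and q: "q \<in> topspace M"
  shows "g q (riemann D X1 X2 X1 q) (X2 q) =
    along X1 B q - along X2 A q - (c1 q * A q + c2 q * B q)"
proof -
  have conn_tangent: "D U V p \<in> T p" if "U \<in> VF" "V \<in> VF" "p \<in> topspace M" for U V p
    using that by (intro vector_fields_at conn_VF)
  \<comment> \<open>Metric compatibility for an inner product that is constant on the
    manifold.\<close>
  have const: "g p (D U V p) (W p) + g p (D U W p) (V p) = 0"
    if "U \<in> VF" "V \<in> VF" "W \<in> VF" "p \<in> topspace M" "\<And>p. p \<in> topspace M \<Longrightarrow> g p (V p) (W p) = c"
    for U V W p c
    using metric_compatible[of U V W p] along_cong[of U p "\<lambda>p. g p (V p) (W p)" "\<lambda>p. c"]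
      along_const[of U p c] metric_sym[of p "V p" "D U W p"] that
    by (simp add: conn_tangent vector_fields_at)
  have parallel: "g p (D U X1 p) (X1 p) = 0" "g p (D U X2 p) (X2 p) = 0"
      "g p (D U X2 p) (X1 p) = - g p (D U X1 p) (X2 p)"
    if "U \<in> VF" "p \<in> topspace M" for U p
    using const[OF that(1) X1 X1 that(2) g11] const[OF that(1) X2 X2 that(2) g22]
      const[OF that(1) X1 X2 that(2) g12] by simp_all
  have bracket: "c1 p *\<^sub>R X1 p + c2 p *\<^sub>R X2 p = D X1 X2 p - D X2 X1 p" if "p \<in> topspace M" for p
    using structure_funs[OF that] torsion_free[OF X1 X2 that] by simp
  \<comment> \<open>\<open>A\<close> and \<open>B\<close> are the inner products of the bracket with
    \<open>X1\<close> and \<open>X2\<close>. Expressed through the torsion identity, one of the two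
    terms vanishes by \<open>parallel\<close> in each case.\<close>
  have \<omega>: "g p (D X1 X1 p) (X2 p) = - A p" "g p (D X2 X1 p) (X2 p) = - B p"
    if p: "p \<in> topspace M" for p
  proof -
    have "A p = g p (D X1 X2 p - D X2 X1 p) (X1 p)" "B p = g p (D X1 X2 p - D X2 X1 p) (X2 p)"
      unfolding bracket[OF p, symmetric] metric_frame[OF p] A B by simp_all
    then show "g p (D X1 X1 p) (X2 p) = - A p" "g p (D X2 X1 p) (X2 p) = - B p"
      using X1 X2 p by (simp_all add: metric_diff_left conn_tangent frame_tangent parallel)
  qed
  have second: "g q (D U (D V X1) q) (X2 q) =
      along U (\<lambda>p. g p (D V X1 p) (X2 p)) q - g q (D V X1 q) (D U X2 q)"
    if "U \<in> VF" "V \<in> VF" for U V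
    using metric_compatible[OF that(1) conn_VF[OF that(2) X1] X2 q] by simp
  have neg: "along U (\<lambda>p. g p (D V X1 p) (X2 p)) q = - along U h q"
    if "U \<in> VF" "h \<in> smooth_funs \<A>" "\<And>p. p \<in> topspace M \<Longrightarrow> g p (D V X1 p) (X2 p) = - h p" for U V h
    using along_cong[OF that(1) q, of "\<lambda>p. g p (D V X1 p) (X2 p)" "\<lambda>p. (-1) * h p"]
      along_scale[OF that(1) q that(2), of "-1"] that(3) by simp
  have smooth: "A \<in> smooth_funs \<A>" "B \<in> smooth_funs \<A>"
    unfolding A[abs_def] B[abs_def]
    by (intro smooth_funs_add smooth_funs_mult smooth_funs_const c1 c2)+
  \<comment> \<open>\<open>D U X1\<close> is orthogonal to \<open>X1\<close> and
    \<open>D U X2\<close> to \<open>X2\<close>, so only the \<open>a12\<close> term of the expansion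
    survives; both sides equal \<open>a12 * A q * B q / \<delta>\<close>.\<close>
  have cross: "g q (D X2 X1 q) (D X1 X2 q) = g q (D X1 X1 q) (D X2 X2 q)"
  proof -
    have "\<delta> * g q (D X2 X1 q) (D X1 X2 q) = \<delta> * g q (D X1 X1 q) (D X2 X2 q)"
      using q X1 X2 by (simp add: metric_expansion conn_tangent parallel)
    then show ?thesis
      using gram_det_nonzero[OF q] by simp
  qed
  have VF: "(\<lambda>p. c1 p *\<^sub>R X1 p) \<in> VF" "(\<lambda>p. c2 p *\<^sub>R X2 p) \<in> VF"
    using c1 c2 X1 X2 by (simp_all add: vector_fields_scale)
  have "D (lie_bracket X1 X2) X1 q = D (\<lambda>p. c1 p *\<^sub>R X1 p + c2 p *\<^sub>R X2 p) X1 q"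
    using X1 X2 q VF structure_funs by (intro conn_cong_left lie_bracket_VF vector_fields_add)
  also have "\<dots> = c1 q *\<^sub>R D X1 X1 q + c2 q *\<^sub>R D X2 X1 q"
    using X1 X2 q VF c1 c2 by (simp add: conn_add_left conn_scale_left)
  finally have "g q (D (lie_bracket X1 X2) X1 q) (X2 q) = - (c1 q * A q + c2 q * B q)"
    using X1 X2 q by (simp add: metric_linear_left conn_tangent frame_tangent \<omega>)
  moreover have "g q (D X1 (D X2 X1) q) (X2 q) =
      - along X1 B q - g q (D X1 X1 q) (D X2 X2 q)"
    "g q (D X2 (D X1 X1) q) (X2 q) = - along X2 A q - g q (D X1 X1 q) (D X2 X2 q)"
    using second X1 X2 neg[OF X1 smooth(2) \<omega>(2)] neg[OF X2 smooth(1) \<omega>(1)] cross by simp_all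
  moreover have "D (lie_bracket X1 X2) X1 q \<in> T q" "D X1 (D X2 X1) q \<in> T q" "D X2 (D X1 X1) q \<in> T q"
    using X1 X2 q by (simp_all add: conn_tangent conn_VF lie_bracket_VF)
  ultimately show ?thesis
    using q by (simp add: riemann_def metric_diff_left frame_tangent subspace_diff subspace_tangent_space)
qed

end

theorem theorem4p1:
  fixes M :: "'a topology"
    and \<A> :: "('a, 2) chart set"
    and g :: "'a metric_tensor"
    and D :: "'a conn"
    and X1 X2 :: "'a vfield"
    and a11 a12 a21 a22 :: real
    and c1 c2 A B \<xi>1 \<xi>2 :: "'a \<Rightarrow> real"
  assumes manifold: "smooth_manifold M \<A>"
    and metric: "lorentzian_metric M \<A> g"
    and levi_civita: "levi_civita M \<A> g D"
    and X1: "X1 \<in> vector_fields M \<A>"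
    and X2: "X2 \<in> vector_fields M \<A>"
    and frame: "\<And>q. q \<in> topspace M \<Longrightarrow> is_basis (X1 q) (X2 q) (tangent_space \<A> q)"
    and g11: "\<And>q. q \<in> topspace M \<Longrightarrow> g q (X1 q) (X1 q) = a11"
    and g22: "\<And>q. q \<in> topspace M \<Longrightarrow> g q (X2 q) (X2 q) = a22"
    and g12: "\<And>q. q \<in> topspace M \<Longrightarrow> g q (X1 q) (X2 q) = a12"
    and g21: "\<And>q. q \<in> topspace M \<Longrightarrow> g q (X2 q) (X1 q) = a21"
    and a_sym: "a12 = a21"
    and c1: "c1 \<in> smooth_funs \<A>"
    and c2: "c2 \<in> smooth_funs \<A>"
    and structure_funs: "\<And>q. q \<in> topspace M \<Longrightarrow>
          lie_bracket X1 X2 q = c1 q *\<^sub>R X1 q + c2 q *\<^sub>R X2 q"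
    and A: "A = (\<lambda>q. a11 * c1 q + a12 * c2 q)"
    and B: "B = (\<lambda>q. a12 * c1 q + a22 * c2 q)"
    and \<xi>1: "\<xi>1 = (\<lambda>q. a12 * ((c1 q * A q + c2 q * B q) - along X1 B q + along X2 A q))"
    and \<xi>2: "\<xi>2 = (\<lambda>q. a11 * (- (c1 q * A q + c2 q * B q) + along X1 B q - along X2 A q))"
  shows "\<forall>q\<in>topspace M.
    sectional_curvature M \<A> g D q (tangent_space \<A> q) =
      (a12 * \<xi>1 q + a22 * \<xi>2 q) /
      (det (vector [vector [a11, a12], vector [a12, a22]] :: real ^ 2 ^ 2))\<^sup>2"
proof
  fix q assume q: "q \<in> topspace M"
  interpret constant_frame M \<A> g D X1 X2 a11 a12 a22
    by unfold_locales (use assms in auto)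
  define S where "S = along X1 B q - along X2 A q - (c1 q * A q + c2 q * B q)"
  have "sectional_curvature M \<A> g D q (tangent_space \<A> q) = S / (a11 * a22 - a12\<^sup>2)"
    unfolding sectional_curvature_frame[OF q] S_def
    using curvature_structure_functions[OF structure_funs c1 c2 _ _ q, of A B] A B by simp
  \<comment> \<open>Here \<open>\<xi>1 q = - a12 * S\<close> and \<open>\<xi>2 q = a11 * S\<close>,
    so one factor of the squared determinant cancels.\<close>
  moreover have "a12 * \<xi>1 q + a22 * \<xi>2 q = (a11 * a22 - a12\<^sup>2) * S"
    unfolding \<xi>1 \<xi>2 S_def by (simp add: algebra_simps power2_eq_square)
  moreover have "det (vector [vector [a11, a12], vector [a12, a22]] :: real ^ 2 ^ 2) =
      a11 * a22 - a12\<^sup>2"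
    by (simp add: det_2 power2_eq_square)
  ultimately show "sectional_curvature M \<A> g D q (tangent_space \<A> q) =
      (a12 * \<xi>1 q + a22 * \<xi>2 q) /
      (det (vector [vector [a11, a12], vector [a12, a22]] :: real ^ 2 ^ 2))\<^sup>2"
    by (simp add: power2_eq_square)
qed

end
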